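(* Let $X\subseteq 2^\omega$. Then $X$ is an $SR^{\mathcal M}$ set if and only if every Borel image of $X$ (in $2^\omega$) is $\mathcal M$-additive and every Borel image of $X$ into $\omega^\omega$ is bounded.
   Context: $2^\omega$ is the Cantor space with coordinatewise addition modulo $2$, and $\mathcal M$ is the $\sigma$-ideal of meager subsets of $2^\omega$. For $H\subseteq 2^\omega\times 2^\omega$ and $x\in 2^\omega$ put $(H)_x=\{y:\langle x,y\rangle\in H\}$. An $\mathcal M$-set is a Borel set $H\subseteq 2^\omega\times 2^\omega$ with $(H)_x\in\mathcal M$ for all $x\in 2^\omega$. A set $X\subseteq 2^\omega$ is an $SR^{\mathcal M}$ set if $\bigcup_{x\in X}(H)_x\in\mathcal M$ for every $\mathcal M$-set $H$. A set $Y\subseteq 2^\omega$ is $\mathcal M$-additive if $Y+F\in\mathcal M$ for every $F\in\mathcal M$. A Borel image of $X$ in $2^\omega$ (respectively, into $\omega^\omega$) is a set $f[X]$ where $f$ is a Borel function from $X$ to $2^\omega$ (respectively, to $\omega^\omega$); equivalently, $f$ may be taken to be Borel on all of $2^\omega$. A set $F\subseteq\omega^\omega$ is bounded if there is $g\in\omega^\omega$ such that for every $f\in F$, $f(n)\le g(n)$ for all but finitely many $n$. *)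

theory Defs
  imports "HOL-Analysis.Analysis"
begin

text \<open>
  Both spaces carry the topology of the library's function type, i.e. the product topology with
  discrete factors; \<open>borel\<close> on these types, and on pairs of them, refers to this topology.
\<close>

type_synonym cantor = "nat \<Rightarrow> bool"
type_synonym baire = "nat \<Rightarrow> nat"

text \<open>Addition modulo 2 on \<open>{0, 1}\<close>, read as truth values, is exclusive or.\<close>

definition cantor_add :: "cantor \<Rightarrow> cantor \<Rightarrow> cantor" where
  "cantor_add x y = (\<lambda>n. x n \<noteq> y n)"

definition cantor_setsum :: "cantor set \<Rightarrow> cantor set \<Rightarrow> cantor set" where
  "cantor_setsum Y F = {cantor_add y z | y z. y \<in> Y \<and> z \<in> F}"

definition nowhere_dense :: "'a::topological_space set \<Rightarrow> bool" where
  "nowhere_dense A \<longleftrightarrow> interior (closure A) = {}"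

definition meager :: "'a::topological_space set \<Rightarrow> bool" where
  "meager A \<longleftrightarrow> (\<exists>N :: nat \<Rightarrow> 'a set. (\<forall>n. nowhere_dense (N n)) \<and> A = (\<Union>n. N n))"

text \<open>The vertical section of \<open>H\<close> at \<open>x\<close> is the relational image \<open>H `` {x}\<close>.\<close>

definition M_set :: "(cantor \<times> cantor) set \<Rightarrow> bool" where
  "M_set H \<longleftrightarrow> H \<in> sets borel \<and> (\<forall>x. meager (H `` {x}))"

definition SR_M :: "cantor set \<Rightarrow> bool" where
  "SR_M X \<longleftrightarrow> (\<forall>H. M_set H \<longrightarrow> meager (\<Union>x\<in>X. H `` {x}))"

definition M_additive :: "cantor set \<Rightarrow> bool" where
  "M_additive Y \<longleftrightarrow> (\<forall>F. meager F \<longrightarrow> meager (cantor_setsum Y F))"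

text \<open>
  A Borel function on an arbitrary (possibly non-Borel) set \<open>X\<close> is one measurable with respect to
  the trace of the Borel \<open>\<sigma>\<close>-algebra on \<open>X\<close>, which is the Borel \<open>\<sigma>\<close>-algebra of the subspace.
\<close>

definition borel_image_of :: "'b::topological_space set \<Rightarrow> 'a::topological_space set \<Rightarrow> bool" where
  "borel_image_of Y X \<longleftrightarrow> (\<exists>f \<in> restrict_space borel X \<rightarrow>\<^sub>M borel. Y = f ` X)"

definition eventually_bounded :: "baire set \<Rightarrow> bool" where
  "eventually_bounded F \<longleftrightarrow> (\<exists>g :: baire. \<forall>f\<in>F. \<forall>\<^sub>F n in sequentially. f n \<le> g n)"

end

theory Submission
  imports Defs
begin

text \<open>
  Forward direction: for a Borel \<open>f\<close> into the Cantor space, the translates \<open>f x + F\<close> of a meager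
  \<open>F\<close> are the sections of an \<open>\<M>\<close>-set once \<open>F\<close> is enlarged to a Borel meager set; for a Borel \<open>f\<close>
  into the Baire space one takes the sets of \<open>y\<close> which, for almost all \<open>n\<close>, have a \<open>1\<close> in
  \<open>{n..h n}\<close>, where \<open>h\<close> is a monotone majorant of \<open>f x\<close>: a meager set covering all of them yields a
  bound.

  Conversely, an \<open>\<M>\<close>-set has sections disjoint from \<open>\<Inter>n. V n x\<close> with \<open>V n x\<close> dense open and
  depending on \<open>x\<close> in a Borel way. The least \<open>m\<close> such that some pattern on \<open>{n..<m}\<close> forces a
  point into \<open>V 0 x, \<dots>, V n x\<close> is a Borel function of \<open>x\<close>, so boundedness of its image on \<open>X\<close> gives
  one interval partition that works for all \<open>x \<in> X\<close>. The patterns then form a Borel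
  function \<open>z\<close>, and every section lies in \<open>z x + F\<close> for the single meager set \<open>F\<close> of points that
  vanish identically on only finitely many intervals.
\<close>

section \<open>Cylinders and translations in spaces of sequences\<close>

text \<open>With this instance the Cantor space is second countable as a countable product, which
  \<open>rect_open_open\<close> needs for both factors.\<close>

instance bool :: second_countable_topology
proof
  show "\<exists>B :: bool set set. countable B \<and> open = generate_topology B"
    by (intro exI[of _ "range lessThan \<union> range greaterThan"]) (auto simp: open_bool_def)
qed

text \<open>One notion serves for cylinders (\<open>{..<n}\<close>), for patterns on a block
  (\<open>{n..<m}\<close>) and for tails (\<open>{n..}\<close>).\<close>

definition agree_on :: "'i set \<Rightarrow> ('i \<Rightarrow> 'a) \<Rightarrow> ('i \<Rightarrow> 'a) set" where
  "agree_on I z = {y. \<forall>k\<in>I. y k = z k}"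

lemma agree_on_antimono: "I \<subseteq> J \<Longrightarrow> agree_on J z \<subseteq> agree_on I z"
  by (auto simp: agree_on_def)

lemma closed_agree_on: "closed (agree_on I z)" for z :: "'i \<Rightarrow> 'a::t2_space"
proof -
  have "agree_on I z = (\<Inter>k\<in>I. {y. y k = z k})"
    by (auto simp: agree_on_def)
  then show ?thesis
    by (simp add: closed_INT closed_Collect_eq)
qed

text \<open>Tychonoff. Compactness is what later makes it a Borel condition on the parameter that a
  block pattern lies inside a parametrised open set.\<close>

lemma compact_agree_on: "compact (agree_on I z)" for z :: "'i \<Rightarrow> bool"
proof -
  have "compact (UNIV :: bool set)"
    by (simp add: finite_imp_compact)
  then have "compact_space (product_topology (\<lambda>i::'i. euclidean :: bool topology) UNIV)"
    unfolding compact_space_product_topology by (simp add: compact_space_def)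
  then have "compact (UNIV :: ('i \<Rightarrow> bool) set)"
    by (simp add: euclidean_product_topology compact_space_def compactin_euclidean_iff)
  from compact_Int_closed[OF this closed_agree_on] show ?thesis by simp
qed

lemma open_agree_on:
  fixes z :: "'i \<Rightarrow> 'a::discrete_topology"
  assumes "finite I"
  shows "open (agree_on I z)"
  using product_topology_basis'[OF assms, of "\<lambda>i. {z i}" "\<lambda>i. i"]
  by (simp add: agree_on_def open_discrete)

lemma open_contains_agree_on:
  fixes U :: "(nat \<Rightarrow> 'a::topological_space) set"
  assumes "open U" "y \<in> U"
  obtains n where "agree_on {..<n} y \<subseteq> U"
proof -
  have "openin (product_topology (\<lambda>i. euclidean) UNIV) U"
    using assms(1) by (simp add: euclidean_product_topology)
  from product_topology_open_contains_basis[OF this assms(2)]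
  obtain X where X: "y \<in> (\<Pi>\<^sub>E i\<in>UNIV. X i)" "finite {i. X i \<noteq> UNIV}" "(\<Pi>\<^sub>E i\<in>UNIV. X i) \<subseteq> U"
    by auto
  obtain n where n: "{i. X i \<noteq> UNIV} \<subseteq> {..<n}"
    using X(2) finite_nat_bounded by auto
  have "agree_on {..<n} y \<subseteq> (\<Pi>\<^sub>E i\<in>UNIV. X i)"
  proof
    fix w assume w: "w \<in> agree_on {..<n} y"
    have "w i \<in> X i" for i
    proof (cases "i < n")
      case True
      then show ?thesis using w X(1) by (auto simp: agree_on_def PiE_iff)
    next
      case False
      then have "X i = UNIV" using n by auto
      then show ?thesis by simp
    qed
    then show "w \<in> (\<Pi>\<^sub>E i\<in>UNIV. X i)" by auto
  qed
  then show ?thesis using that X(3) by blast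
qed

lemma cantor_add_cantor_add [simp]: "cantor_add x (cantor_add x y) = y"
  by (auto simp: cantor_add_def)

lemma continuous_cantor_add: "continuous_on UNIV (cantor_add x)"
proof (rule continuous_on_coordinatewise_then_product)
  fix i
  have "continuous_on UNIV (\<lambda>b :: bool. x i \<noteq> b)"
    by simp
  from continuous_on_compose2[OF this continuous_on_product_coordinates[of i]]
  show "continuous_on UNIV (\<lambda>y. cantor_add x y i)"
    by (simp add: cantor_add_def)
qed

lemma image_cantor_add: "cantor_add x ` A = cantor_add x -` A"
  by (auto simp: image_iff) (metis cantor_add_cantor_add)

lemma open_image_cantor_add: "open A \<Longrightarrow> open (cantor_add x ` A)"
  unfolding image_cantor_add by (rule open_vimage[OF _ continuous_cantor_add])

section \<open>Dense open sets and meager sets\<close>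

lemma closure_Int_dense_open:
  assumes "closure V = UNIV" "open V" "closure W = UNIV"
  shows "closure (V \<inter> W) = UNIV"
  using assms closure_open_Int_superset[of V W] by auto

lemma dense_iff: "closure V = UNIV \<longleftrightarrow> (\<forall>U. open U \<longrightarrow> U \<noteq> {} \<longrightarrow> U \<inter> V \<noteq> {})"
proof -
  have "closure V = UNIV \<longleftrightarrow> interior (- V) = {}"
    by (auto simp: interior_complement)
  also have "\<dots> \<longleftrightarrow> (\<forall>U. open U \<longrightarrow> U \<noteq> {} \<longrightarrow> U \<inter> V \<noteq> {})"
    by (auto simp: interior_def)
  finally show ?thesis .
qed

lemma nowhere_dense_iff: "nowhere_dense A \<longleftrightarrow> closure (- closure A) = UNIV"
  by (auto simp: nowhere_dense_def closure_complement)

lemma nowhere_dense_closed: "closed A \<Longrightarrow> nowhere_dense A \<longleftrightarrow> closure (- A) = UNIV"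
  by (auto simp: nowhere_dense_def closure_complement)

lemma meager_subset: "meager B \<Longrightarrow> A \<subseteq> B \<Longrightarrow> meager A"
proof -
  assume B: "meager B" "A \<subseteq> B"
  then obtain N where "\<And>n::nat. nowhere_dense (N n)" "B = (\<Union>n. N n)"
    by (auto simp: meager_def)
  moreover have "nowhere_dense (A \<inter> N n)" if "nowhere_dense (N n)" for n
    using that interior_mono[OF closure_mono, of "A \<inter> N n" "N n"] by (auto simp: nowhere_dense_def)
  ultimately show ?thesis
    unfolding meager_def using B(2) by (intro exI[of _ "\<lambda>n. A \<inter> N n"]) auto
qed

lemma meager_iff_dense_open:
  "meager A \<longleftrightarrow> (\<exists>V :: nat \<Rightarrow> 'a set. (\<forall>n. open (V n) \<and> closure (V n) = UNIV) \<and> A \<inter> (\<Inter>n. V n) = {})"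
  for A :: "'a::topological_space set"
proof
  assume "meager A"
  then obtain N where N: "\<And>n::nat. nowhere_dense (N n)" "A = (\<Union>n. N n)"
    by (auto simp: meager_def)
  then show "\<exists>V :: nat \<Rightarrow> 'a set. (\<forall>n. open (V n) \<and> closure (V n) = UNIV) \<and> A \<inter> (\<Inter>n. V n) = {}"
    by (intro exI[of _ "\<lambda>n. - closure (N n)"]) (auto simp: nowhere_dense_iff intro: subsetD[OF closure_subset])
next
  assume "\<exists>V :: nat \<Rightarrow> 'a set. (\<forall>n. open (V n) \<and> closure (V n) = UNIV) \<and> A \<inter> (\<Inter>n. V n) = {}"
  then obtain V :: "nat \<Rightarrow> 'a set" where V: "\<And>n. open (V n)" "\<And>n. closure (V n) = UNIV" "A \<inter> (\<Inter>n. V n) = {}"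
    by auto
  have "meager (\<Union>n. - V n)"
    unfolding meager_def using V by (intro exI[of _ "\<lambda>n. - V n"]) (auto simp: nowhere_dense_closed closed_Compl)
  then show "meager A"
    by (rule meager_subset) (use V(3) in auto)
qed

lemma dense_open_INT:
  assumes "finite I" "\<And>i. i \<in> I \<Longrightarrow> open (V i)" "\<And>i. i \<in> I \<Longrightarrow> closure (V i) = UNIV"
  shows "closure (\<Inter>i\<in>I. V i) = UNIV"
  using assms by (induction I) (simp_all add: closure_Int_dense_open)

lemma dense_image_cantor_add:
  assumes "closure V = UNIV"
  shows "closure (cantor_add s ` V) = UNIV"
  unfolding dense_iff
proof (intro allI impI)
  fix U :: "cantor set" assume U: "open U" "U \<noteq> {}"
  then have "cantor_add s ` U \<inter> V \<noteq> {}"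
    using assms open_image_cantor_add[of U s] by (auto simp: dense_iff)
  then obtain u where u: "u \<in> U" "cantor_add s u \<in> V"
    by auto
  then have "u \<in> cantor_add s ` V"
    by (intro image_eqI[of _ _ "cantor_add s u"]) auto
  then show "U \<inter> cantor_add s ` V \<noteq> {}"
    using u by auto
qed

text \<open>
  The finitely many translates of \<^term>\<open>V\<close> by points supported below \<^term>\<open>n\<close> have a dense open
  intersection; a cylinder inside it keeps lying in \<^term>\<open>V\<close> when its first \<^term>\<open>n\<close> coordinates
  are freed.
\<close>

lemma dense_open_contains_agree_on:
  fixes V :: "cantor set"
  assumes V: "open V" "closure V = UNIV"
  obtains m z where "n \<le> m" "agree_on {n..<m} z \<subseteq> V"
proof -
  define S where "S = {s :: cantor. \<forall>k\<ge>n. \<not> s k}"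
  have "S \<subseteq> (\<lambda>A k. k \<in> A) ` Pow {..<n}"
  proof
    fix s assume "s \<in> S"
    then have "{k. s k} \<subseteq> {..<n}"
      by (force simp: S_def not_less[symmetric])
    then show "s \<in> (\<lambda>A k. k \<in> A) ` Pow {..<n}"
      by (intro image_eqI[of _ _ "{k. s k}"]) auto
  qed
  then have "finite S"
    by (rule finite_subset) auto
  define W where "W = (\<Inter>s\<in>S. cantor_add s ` V)"
  have "open W"
    unfolding W_def using \<open>finite S\<close> V open_image_cantor_add by blast
  moreover have "closure W = UNIV"
    unfolding W_def using \<open>finite S\<close> V open_image_cantor_add dense_image_cantor_add
    by (intro dense_open_INT) auto
  then have "W \<noteq> {}"
    by auto
  ultimately obtain y m where m: "agree_on {..<m} y \<subseteq> W"
    using open_contains_agree_on by (metis ex_in_conv)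
  have "agree_on {n..<max n m} y \<subseteq> V"
  proof
    fix y' assume y': "y' \<in> agree_on {n..<max n m} y"
    \<comment> \<open>Adding \<open>s\<close> resets the bits of \<open>y'\<close> below
      \<open>n\<close> to those of \<open>y\<close>.\<close>
    define s where "s k \<longleftrightarrow> k < n \<and> y' k \<noteq> y k" for k
    have "cantor_add s y' \<in> agree_on {..<m} y"
      using y' by (auto simp: agree_on_def cantor_add_def s_def)
    moreover have "s \<in> S"
      by (auto simp: S_def s_def)
    ultimately have "cantor_add s y' \<in> cantor_add s ` V"
      using m by (auto simp: W_def)
    then show "y' \<in> V"
      by (metis cantor_add_cantor_add imageE)
  qed
  then show ?thesis
    using that[of "max n m" y] by auto
qed

section \<open>Combinatorial description of meager sets\<close>

text \<open>For increasing \<open>a\<close>, the pair \<open>(a, z)\<close> is a chopped real: an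
  interval partition together with a pattern on each interval. These sets are cofinal among the
  meager sets.\<close>

definition eventually_avoiding :: "(nat \<Rightarrow> nat) \<Rightarrow> cantor \<Rightarrow> cantor set" where
  "eventually_avoiding a z =
    {y. \<forall>\<^sub>F k in sequentially. y \<notin> agree_on {a k..<a (Suc k)} z}"

definition block_of :: "(nat \<Rightarrow> nat) \<Rightarrow> nat \<Rightarrow> nat" where
  "block_of a n = (LEAST k. n < a (Suc k))"

lemma block_of_eq:
  assumes "strict_mono a" "j \<in> {a k..<a (Suc k)}"
  shows "block_of a j = k"
  unfolding block_of_def
proof (rule Least_equality)
  fix l assume "j < a (Suc l)"
  then have "a k < a (Suc l)"
    using assms by simp
  then show "k \<le> l"
    using assms(1) by (simp add: strict_mono_less)
qed (use assms in simp)

lemma in_block_of: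
  assumes "strict_mono a" "a 0 = 0"
  shows "n \<in> {a (block_of a n)..<a (Suc (block_of a n))}"
proof -
  have "n < a (Suc n)"
    using strict_mono_imp_increasing[OF assms(1), of "Suc n"] by simp
  then have upper: "n < a (Suc (block_of a n))"
    unfolding block_of_def by (rule LeastI)
  have "a (block_of a n) \<le> n"
  proof (cases "block_of a n")
    case (Suc k)
    then have "\<not> n < a (Suc k)"
      using not_less_Least[of k "\<lambda>k. n < a (Suc k)"] by (simp add: block_of_def)
    then show ?thesis
      by (simp add: Suc)
  qed (simp add: assms)
  with upper show ?thesis
    by simp
qed

text \<open>Since \<open>a k >= k\<close>, all blocks of index at least \<open>n\<close> lie in the
  tail. This is the test by which spliced points are shown to escape the set.\<close>

lemma agree_on_not_eventually_avoiding:
  assumes "strict_mono a" "y \<in> agree_on {n..} z"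
  shows "y \<notin> eventually_avoiding a z"
proof -
  have "y \<in> agree_on {a k..<a (Suc k)} z" if "k \<ge> n" for k
    using assms that strict_mono_imp_increasing[OF assms(1), of k] by (auto simp: agree_on_def)
  then show ?thesis
    unfolding eventually_avoiding_def eventually_sequentially by (auto intro: exI[of _ "max n _"])
      (meson max.cobounded1 max.cobounded2)
qed

text \<open>Fixing the index from which matches stop gives a closed set, because matching a block is
  an open condition; any finite initial segment can be continued by \<open>z\<close>, so the
  complement is dense.\<close>

lemma meager_eventually_avoiding:
  assumes a: "strict_mono a"
  shows "meager (eventually_avoiding a z)"
proof -
  define N where "N n = {y. \<forall>k\<ge>n. y \<notin> agree_on {a k..<a (Suc k)} z}" for n
  have N: "N n = (\<Inter>k\<in>{n..}. - agree_on {a k..<a (Suc k)} z)" for n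
    by (auto simp: N_def)
  have "nowhere_dense (N n)" for n
  proof -
    have "closed (N n)"
      unfolding N by (intro closed_INT ballI closed_Compl open_agree_on) auto
    moreover have "closure (- N n) = UNIV"
      unfolding dense_iff
    proof (intro allI impI)
      fix U :: "cantor set" assume "open U" "U \<noteq> {}"
      then obtain y m where m: "agree_on {..<m} y \<subseteq> U"
        using open_contains_agree_on by (metis ex_in_conv)
      define w where "w k = (if k < m then y k else z k)" for k
      have "w \<in> agree_on {m..} z"
        by (auto simp: w_def agree_on_def)
      then have "w \<notin> N n"
        using agree_on_not_eventually_avoiding[OF a]
        by (force simp: eventually_avoiding_def eventually_sequentially N_def)
      moreover have "w \<in> U"
        using m by (auto simp: w_def agree_on_def)
      ultimately show "U \<inter> - N n \<noteq> {}"
        by auto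
    qed
    ultimately show ?thesis
      by (simp add: nowhere_dense_closed)
  qed
  moreover have "eventually_avoiding a z = (\<Union>n. N n)"
    by (auto simp: eventually_avoiding_def eventually_sequentially N_def)
  ultimately show ?thesis
    unfolding meager_def by auto
qed

text \<open>Iterating \<open>dense_open_contains_agree_on\<close> yields consecutive blocks whose
  patterns force a point into more and more of the dense open sets; matching infinitely many of them
  forces it into all. The true last bit of each block is a normalisation used when bounds are read
  off.\<close>

lemma meager_subset_eventually_avoiding:
  assumes "meager M"
  obtains a z where "strict_mono a" "a 0 = 0" "\<And>k. z (a (Suc k) - 1)" "M \<subseteq> eventually_avoiding a z"
proof -
  obtain V :: "nat \<Rightarrow> cantor set" where V: "\<And>n. open (V n)" "\<And>n. closure (V n) = UNIV" "M \<inter> (\<Inter>n. V n) = {}"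
    using assms by (auto simp: meager_iff_dense_open)
  define W where "W n = (\<Inter>j\<le>n. V j)" for n
  have "\<exists>m z. n < m \<and> z (m - 1) \<and> agree_on {n..<m} z \<subseteq> W n" for n
  proof -
    have "open (W n)" "closure (W n) = UNIV"
      unfolding W_def by (intro open_INT dense_open_INT; use V in simp)+
    then obtain m z where m: "n \<le> m" "agree_on {n..<m} z \<subseteq> W n"
      using dense_open_contains_agree_on by metis
    \<comment> \<open>One more coordinate makes the block nonempty and lets its last bit be set to
      true.\<close>
    have "agree_on {n..<Suc m} (z(m := True)) \<subseteq> agree_on {n..<m} z"
      by (auto simp: agree_on_def)
    then show ?thesis
      using m by (intro exI[of _ "Suc m"] exI[of _ "z(m := True)"]) auto
  qed
  then obtain m \<zeta> where m: "\<And>n. n < m n" "\<And>n. \<zeta> n (m n - 1)" "\<And>n. agree_on {n..<m n} (\<zeta> n) \<subseteq> W n"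
    by metis
  \<comment> \<open>Iterating \<open>m\<close> from 0 makes each block begin where the previous one
    ends.\<close>
  define a where "a k = (m ^^ k) 0" for k
  have a_Suc: "a (Suc k) = m (a k)" for k
    by (simp add: a_def)
  have a: "strict_mono a"
    by (simp add: strict_mono_Suc_iff a_Suc m)
  define z where "z j = \<zeta> (a (block_of a j)) j" for j
  have z: "z j = \<zeta> (a k) j" if "j \<in> {a k..<a (Suc k)}" for j k
    using block_of_eq[OF a that] by (simp add: z_def)
  show ?thesis
  proof
    show "z (a (Suc k) - 1)" for k
      using z[of "a (Suc k) - 1" k] m(1,2)[of "a k"] by (auto simp: a_Suc)
    show "M \<subseteq> eventually_avoiding a z"
    proof
      fix y assume "y \<in> M"
      then obtain j where j: "y \<notin> V j"
        using V(3) by auto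
      have "y \<notin> agree_on {a k..<a (Suc k)} z" if "k \<ge> j" for k
      proof
        assume "y \<in> agree_on {a k..<a (Suc k)} z"
        then have "y \<in> agree_on {a k..<m (a k)} (\<zeta> (a k))"
          using z by (simp add: agree_on_def a_Suc)
        then have "y \<in> W (a k)"
          using m(3) by blast
        moreover have "j \<le> a k"
          using that strict_mono_imp_increasing[OF a, of k] by simp
        ultimately show False
          using j by (auto simp: W_def)
      qed
      then show "y \<in> eventually_avoiding a z"
        by (auto simp: eventually_avoiding_def eventually_sequentially)
    qed
  qed (simp_all add: a, simp add: a_def)
qed

text \<open>Baire category theorem for the Cantor space, read off from the combinatorial form: an
  initial segment inside \<open>U\<close> continued by \<open>z\<close> matches almost all
  blocks.\<close>

lemma open_not_meager:
  fixes U :: "cantor set"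
  assumes "open U" "U \<noteq> {}"
  shows "\<not> meager U"
proof
  assume "meager U"
  then obtain a z where a: "strict_mono a" "U \<subseteq> eventually_avoiding a z"
    using meager_subset_eventually_avoiding by metis
  obtain y m where m: "agree_on {..<m} y \<subseteq> U"
    using assms open_contains_agree_on by (metis ex_in_conv)
  define w where "w k = (if k < m then y k else z k)" for k
  have "w \<in> U" "w \<in> agree_on {m..} z"
    using m by (auto simp: w_def agree_on_def)
  then show False
    using agree_on_not_eventually_avoiding a by blast
qed

section \<open>Open sets depending on a Borel parameter\<close>

text \<open>A parametrised open set. The first factors are merely Borel, since open ones would not
  survive the sectionwise exterior in \<open>rect_open_exterior\<close>.\<close>

definition rect_open :: "('a::topological_space \<times> 'b::topological_space) set \<Rightarrow> bool" where
  "rect_open G \<longleftrightarrow> (\<exists>A B. (\<forall>i::nat. A i \<in> sets borel \<and> open (B i)) \<and> G = (\<Union>i. A i \<times> B i))"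

lemma rect_openE:
  assumes "rect_open G"
  obtains A B where "\<And>i::nat. A i \<in> sets borel" "\<And>i. open (B i)" "G = (\<Union>i. A i \<times> B i)"
proof -
  from assms obtain A B
    where AB: "\<forall>i::nat. A i \<in> sets borel \<and> open (B i)" and G: "G = (\<Union>i. A i \<times> B i)"
    unfolding rect_open_def by (elim exE conjE) (rule that)
  show ?thesis
    by (rule that[OF _ _ G]) (simp_all add: AB)
qed

lemma rect_open_UN_countable:
  assumes "countable I" "\<And>i. i \<in> I \<Longrightarrow> A i \<in> sets borel" "\<And>i. i \<in> I \<Longrightarrow> open (B i)"
  shows "rect_open (\<Union>i\<in>I. A i \<times> B i)"
proof (cases "I = {}")
  case True
  then show ?thesis
    unfolding rect_open_def by (intro exI[of _ "\<lambda>_. {}"]) auto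
next
  case False
  have "(\<Union>i\<in>I. A i \<times> B i) = (\<Union>i\<in>range (from_nat_into I). A i \<times> B i)"
    by (simp only: range_from_nat_into[OF False assms(1)])
  also have "\<dots> = (\<Union>n. A (from_nat_into I n) \<times> B (from_nat_into I n))"
    by (simp only: image_image)
  finally have I: "(\<Union>i\<in>I. A i \<times> B i) = (\<Union>n. A (from_nat_into I n) \<times> B (from_nat_into I n))" .
  show ?thesis
    unfolding rect_open_def using False assms from_nat_into[OF False]
    by (intro exI[of _ "\<lambda>n. A (from_nat_into I n)"] exI[of _ "\<lambda>n. B (from_nat_into I n)"])
       (auto simp: I)
qed

lemma rect_open_UN:
  assumes "\<And>n::nat. rect_open (G n)"
  shows "rect_open (\<Union>n. G n)"
proof -
  have "\<forall>n. \<exists>p. (\<forall>i::nat. fst p i \<in> sets borel \<and> open (snd p i)) \<and> G n = (\<Union>i. fst p i \<times> snd p i)"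
    using assms unfolding rect_open_def by simp
  from choice[OF this] obtain p
    where p: "\<forall>n. (\<forall>i::nat. fst (p n) i \<in> sets borel \<and> open (snd (p n) i)) \<and>
      G n = (\<Union>i. fst (p n) i \<times> snd (p n) i)" ..
  have "(\<Union>n. G n) = (\<Union>(n, i)\<in>UNIV. fst (p n) i \<times> snd (p n) i)"
    using p by (simp add: set_eq_iff split_paired_Ex)
  also have "rect_open \<dots>"
    using p rect_open_UN_countable[of UNIV "\<lambda>(n, i). fst (p n) i" "\<lambda>(n, i). snd (p n) i"]
    by (simp add: case_prod_unfold)
  finally show ?thesis .
qed

lemma rect_open_Un: "rect_open G \<Longrightarrow> rect_open G' \<Longrightarrow> rect_open (G \<union> G')"
proof -
  assume "rect_open G" "rect_open G'"
  then have "rect_open (\<Union>n::nat. if n = 0 then G else G')"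
    by (intro rect_open_UN) simp
  also have "(\<Union>n::nat. if n = 0 then G else G') = G \<union> G'"
    by (auto split: if_splits)
  finally show ?thesis .
qed

lemma open_rect_open_section: "rect_open G \<Longrightarrow> open (G `` {x})"
proof -
  assume "rect_open G"
  then obtain A B where AB: "\<And>i::nat. open (B i)" "G = (\<Union>i. A i \<times> B i)"
    by (auto simp: rect_open_def)
  have "G `` {x} = (\<Union>i\<in>{i. x \<in> A i}. B i)"
    by (auto simp: AB(2))
  then show ?thesis
    using AB(1) by (simp add: open_UN)
qed

lemma rect_open_open:
  fixes G :: "('a::second_countable_topology \<times> 'b::second_countable_topology) set"
  assumes "open G"
  shows "rect_open G"
proof -
  obtain \<A> :: "'a set set" where \<A>: "countable \<A>" "topological_basis \<A>"
    using ex_countable_basis by auto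
  obtain \<B> :: "'b set set" where \<B>: "countable \<B>" "topological_basis \<B>"
    using ex_countable_basis by auto
  define I where "I = {p \<in> \<A> \<times> \<B>. fst p \<times> snd p \<subseteq> G}"
  have "\<exists>p\<in>I. w \<in> fst p \<times> snd p" if "w \<in> G" for w
  proof -
    obtain S T where ST: "open S" "open T" "w \<in> S \<times> T" "S \<times> T \<subseteq> G"
      using open_prod_elim[OF assms \<open>w \<in> G\<close>] .
    obtain A where A: "A \<in> \<A>" "fst w \<in> A" "A \<subseteq> S"
      using topological_basisE[OF \<A>(2) ST(1), of "fst w"] ST(3) by (metis mem_Times_iff)
    obtain B where B: "B \<in> \<B>" "snd w \<in> B" "B \<subseteq> T"
      using topological_basisE[OF \<B>(2) ST(2), of "snd w"] ST(3) by (metis mem_Times_iff)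
    show ?thesis
      using A B ST(4) by (intro bexI[of _ "(A, B)"]) (auto simp: I_def mem_Times_iff)
  qed
  then have "G = (\<Union>p\<in>I. fst p \<times> snd p)"
    by (auto simp: I_def)
  moreover have "rect_open (\<Union>p\<in>I. fst p \<times> snd p)"
  proof (rule rect_open_UN_countable)
    show "countable I"
      unfolding I_def using \<A>(1) \<B>(1) by (intro countable_subset[OF _ countable_SIGMA]) auto
  qed (use topological_basis_open[OF \<A>(2)] topological_basis_open[OF \<B>(2)] in \<open>auto simp: I_def\<close>)
  ultimately show ?thesis
    by simp
qed

text \<open>The witness is the exterior of \<open>G\<close> taken in every section; a countable
  basis of the second space makes it depend on the parameter in a Borel way.\<close>

lemma rect_open_exterior:
  fixes G :: "('a::topological_space \<times> 'b::second_countable_topology) set"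
  assumes "rect_open G"
  obtains G' where "rect_open G'" "G \<inter> G' = {}" "\<And>x. closure ((G \<union> G') `` {x}) = UNIV"
proof -
  obtain A B where AB: "\<And>i::nat. A i \<in> sets borel" "\<And>i. open (B i)" "G = (\<Union>i. A i \<times> B i)"
    by (rule rect_openE[OF assms(1)]) (rule that)
  obtain \<C> :: "'b set set" where \<C>: "countable \<C>" "topological_basis \<C>"
    using ex_countable_basis by auto
  \<comment> \<open>\<open>E C\<close> collects the parameters \<open>x\<close> for which
    \<open>C\<close> misses the section of \<open>G\<close> at \<open>x\<close>.\<close>
  define E where "E C = (\<Inter>i\<in>{i. C \<inter> B i \<noteq> {}}. - A i)" for C
  define G' where "G' = (\<Union>C\<in>\<C>. E C \<times> C)"
  show ?thesis
  proof
    have "E C \<in> sets borel" for C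
      unfolding E_def using AB(1) by (cases "{i. C \<inter> B i \<noteq> {}} = {}") auto
    then show "rect_open G'"
      unfolding G'_def using \<C> topological_basis_open by (intro rect_open_UN_countable) auto
    show "G \<inter> G' = {}"
      by (auto simp: AB(3) G'_def E_def)
    show "closure ((G \<union> G') `` {x}) = UNIV" for x
      unfolding dense_iff
    proof (intro allI impI)
      fix O' :: "'b set" assume "open O'" "O' \<noteq> {}"
      then obtain y C where C: "C \<in> \<C>" "y \<in> C" "C \<subseteq> O'"
        by (meson topological_basisE[OF \<C>(2)] ex_in_conv)
      show "O' \<inter> (G \<union> G') `` {x} \<noteq> {}"
      proof (cases "x \<in> E C")
        case True
        then have "(x, y) \<in> G'"
          using C by (auto simp: G'_def)
        then show ?thesis
          using C by auto
      next
        case False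
        then obtain i w where "x \<in> A i" "w \<in> C" "w \<in> B i"
          by (auto simp: E_def)
        then have "(x, w) \<in> G" "w \<in> O'"
          using C by (auto simp: AB(3))
        then show ?thesis
          by auto
      qed
    qed
  qed
qed

text \<open>By compactness finitely many of the open factors cover \<open>K\<close>, and there are
  only countably many finite index sets, so the condition is a countable union of finite
  intersections of Borel sets.\<close>

lemma rect_open_compact_section:
  assumes "rect_open G" "compact K"
  shows "{x. K \<subseteq> G `` {x}} \<in> sets borel"
proof -
  obtain A B where AB: "\<And>i::nat. A i \<in> sets borel" "\<And>i. open (B i)" "G = (\<Union>i. A i \<times> B i)"
    by (rule rect_openE[OF assms(1)]) (rule that)
  define \<F> where "\<F> = {F. finite F \<and> K \<subseteq> (\<Union>i\<in>F. B i)}"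
  have "{x. K \<subseteq> G `` {x}} = (\<Union>F\<in>\<F>. \<Inter>i\<in>F. A i)"
  proof (intro set_eqI iffI)
    fix x assume "x \<in> {x. K \<subseteq> G `` {x}}"
    then have "K \<subseteq> (\<Union>i\<in>{i. x \<in> A i}. B i)"
      by (auto simp: AB(3))
    then obtain F where "F \<subseteq> {i. x \<in> A i}" "finite F" "K \<subseteq> (\<Union>i\<in>F. B i)"
      using compactE_image[OF assms(2), of "{i. x \<in> A i}" B] AB(2) by metis
    then show "x \<in> (\<Union>F\<in>\<F>. \<Inter>i\<in>F. A i)"
      by (auto simp: \<F>_def)
  qed (fastforce simp: AB(3) \<F>_def)
  moreover have "countable \<F>"
    unfolding \<F>_def by (rule countable_subset[OF _ countable_Collect_finite]) auto
  moreover have "(\<Inter>i\<in>F. A i) \<in> sets borel" if "F \<in> \<F>" for F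
    using that AB(1) by (cases "F = {}") (auto simp: \<F>_def)
  ultimately show ?thesis
    by auto
qed

text \<open>
  A version of density and of the Baire property that is uniform in the first coordinate: all the
  open sets involved depend on the parameter in a Borel way.
\<close>

definition dense_rect_opens :: "(nat \<Rightarrow> ('a::topological_space \<times> 'b::topological_space) set) \<Rightarrow> bool" where
  "dense_rect_opens V \<longleftrightarrow> (\<forall>n. rect_open (V n) \<and> (\<forall>x. closure (V n `` {x}) = UNIV))"

text \<open>Induction on the generation of the Borel sets. In the witness, \<open>fst p\<close> is
  the parametrised open set and \<open>snd p\<close> the sequence of dense open sets outside whose
  intersection it may differ from \<open>H\<close>.\<close>

lemma borel_eq_rect_open_on_comeager:
  fixes H :: "('a::second_countable_topology \<times> 'b::second_countable_topology) set"
  assumes "H \<in> sets borel"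
  shows "\<exists>p. rect_open (fst p) \<and> dense_rect_opens (snd p) \<and>
    H \<inter> (\<Inter>n. snd p n) = fst p \<inter> (\<Inter>n. snd p n)"
proof -
  have UNIV: "dense_rect_opens (\<lambda>_. UNIV :: ('a \<times> 'b) set)"
    using rect_open_open[OF open_UNIV] by (auto simp: dense_rect_opens_def Image_def)
  have "H \<in> sigma_sets UNIV {S. open S}"
    using assms by (simp add: borel_def)
  then show ?thesis
  proof induction
    case (Basic G)
    then show ?case
      using rect_open_open[of G] UNIV by (intro exI[of _ "(G, \<lambda>_. UNIV)"]) simp
  next
    case Empty
    then show ?case
      using rect_open_open[OF open_empty] UNIV by (intro exI[of _ "({}, \<lambda>_. UNIV)"]) simp
  next
    case (Compl G)
    from Compl.IH obtain p where p: "rect_open (fst p)" "dense_rect_opens (snd p)"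
      "G \<inter> (\<Inter>n. snd p n) = fst p \<inter> (\<Inter>n. snd p n)"
      by (elim exE conjE) (rule that)
    obtain U' where U': "rect_open U'" "fst p \<inter> U' = {}" "\<And>x. closure ((fst p \<union> U') `` {x}) = UNIV"
      by (rule rect_open_exterior[OF p(1)]) (rule that)
    \<comment> \<open>A new dense open set, the union of \<open>fst p\<close> and \<open>U'\<close>,
      is put in front: within it, lying outside \<open>fst p\<close> means lying in
      \<open>U'\<close>.\<close>
    define V' where "V' = case_nat (fst p \<union> U') (snd p)"
    have V': "(\<Inter>n. V' n) = (fst p \<union> U') \<inter> (\<Inter>n. snd p n)"
      unfolding V'_def by (subst UNIV_nat_eq) (simp add: image_image)
    have "(UNIV - G) \<inter> ((U \<union> U') \<inter> D) = U' \<inter> ((U \<union> U') \<inter> D)"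
      if "G \<inter> D = U \<inter> D" "U \<inter> U' = {}" for U D
      using that by blast
    from this[OF p(3) U'(2)] have "(UNIV - G) \<inter> (\<Inter>n. V' n) = U' \<inter> (\<Inter>n. V' n)"
      by (simp only: V')
    moreover have "rect_open (V' n) \<and> closure (V' n `` {x}) = UNIV" for n x
      using p(1,2) U'(1,3) by (cases n) (simp_all add: V'_def rect_open_Un dense_rect_opens_def)
    ultimately show ?case
      using U'(1) by (intro exI[of _ "(U', V')"]) (simp add: dense_rect_opens_def)
  next
    case (Union G)
    then have "\<forall>i. \<exists>p. rect_open (fst p) \<and> dense_rect_opens (snd p) \<and>
        G i \<inter> (\<Inter>n. snd p n) = fst p \<inter> (\<Inter>n. snd p n)"
      by simp
    from choice[OF this] obtain p where p: "\<forall>i. rect_open (fst (p i)) \<and> dense_rect_opens (snd (p i)) \<and>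
        G i \<inter> (\<Inter>n. snd (p i) n) = fst (p i) \<inter> (\<Inter>n. snd (p i) n)" ..
    \<comment> \<open>The countably many sequences are merged into one through the pairing of
      natural numbers.\<close>
    define V' where "V' n = (case prod_decode n of (i, n) \<Rightarrow> snd (p i) n)" for n
    have "(\<Inter>n. V' n) \<subseteq> snd (p i) n" for i n
      using INT_lower[of "prod_encode (i, n)" UNIV V'] by (simp add: V'_def)
    then have V': "(\<Inter>n. V' n) \<subseteq> (\<Inter>n. snd (p i) n)" for i
      by blast
    have "G i \<inter> (\<Inter>n. V' n) = fst (p i) \<inter> (\<Inter>n. V' n)" for i
    proof -
      have "G i \<inter> (\<Inter>n. snd (p i) n) = fst (p i) \<inter> (\<Inter>n. snd (p i) n)"
        using p by simp
      moreover have "A \<inter> E = B \<inter> E" if "A \<inter> D = B \<inter> D" "E \<subseteq> D" for A B D E :: "('a \<times> 'b) set"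
        using that by blast
      ultimately show ?thesis
        using V' by metis
    qed
    then have "(\<Union>i. G i) \<inter> (\<Inter>n. V' n) = (\<Union>i. fst (p i)) \<inter> (\<Inter>n. V' n)"
      by (simp only: Int_commute[of _ "\<Inter>n. V' n"] Int_UN_distrib)
    moreover have "rect_open (\<Union>i. fst (p i))" "dense_rect_opens V'"
      using p by (auto simp: V'_def dense_rect_opens_def intro: rect_open_UN split: prod.splits)
    ultimately show ?case
      by (intro exI[of _ "(\<Union>i. fst (p i), V')"]) simp
  qed
qed

section \<open>Block patterns avoided by an M-set\<close>

lemma meager_Un:
  assumes "meager A" "meager B"
  shows "meager (A \<union> B)"
proof -
  obtain V :: "nat \<Rightarrow> 'a set" where V: "\<And>n. open (V n)" "\<And>n. closure (V n) = UNIV" "A \<inter> (\<Inter>n. V n) = {}"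
    using assms(1) by (auto simp: meager_iff_dense_open)
  obtain W :: "nat \<Rightarrow> 'a set" where W: "\<And>n. open (W n)" "\<And>n. closure (W n) = UNIV" "B \<inter> (\<Inter>n. W n) = {}"
    using assms(2) by (auto simp: meager_iff_dense_open)
  show ?thesis
    unfolding meager_iff_dense_open
  proof (intro exI[of _ "\<lambda>n. V n \<inter> W n"] conjI allI)
    show "(A \<union> B) \<inter> (\<Inter>n. V n \<inter> W n) = {}"
      using V(3) W(3) by blast
  qed (use V W in \<open>simp_all add: closure_Int_dense_open open_Int\<close>)
qed

text \<open>The open set approximating \<open>H\<close> has sections covered by two meager sets, so
  it is empty by Baire category; hence \<open>H\<close> misses the intersection of the dense open
  sets.\<close>

lemma M_set_avoids_rect_open:
  assumes "M_set H"
  obtains V where "dense_rect_opens V" "H \<inter> (\<Inter>n. V n) = {}"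
proof -
  from assms have "H \<in> sets borel"
    by (simp add: M_set_def)
  from borel_eq_rect_open_on_comeager[OF this] obtain p where p: "rect_open (fst p)" "dense_rect_opens (snd p)"
    "H \<inter> (\<Inter>n. snd p n) = fst p \<inter> (\<Inter>n. snd p n)"
    by (elim exE conjE) (rule that)
  have "fst p `` {x} = {}" for x
  proof -
    have "meager (- (\<Inter>n. snd p n `` {x}))"
      unfolding meager_iff_dense_open using p(2)
      by (intro exI[of _ "\<lambda>n. snd p n `` {x}"]) (auto simp: dense_rect_opens_def intro: open_rect_open_section)
    then have "meager (H `` {x} \<union> - (\<Inter>n. snd p n `` {x}))"
      using assms by (intro meager_Un) (auto simp: M_set_def)
    moreover have "fst p `` {x} \<subseteq> H `` {x} \<union> - (\<Inter>n. snd p n `` {x})"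
    proof
      fix y assume y: "y \<in> fst p `` {x}"
      have "(x, y) \<in> H \<inter> (\<Inter>n. snd p n)" if "y \<in> (\<Inter>n. snd p n `` {x})"
        unfolding p(3) using y that by simp
      then show "y \<in> H `` {x} \<union> - (\<Inter>n. snd p n `` {x})"
        by auto
    qed
    ultimately have "meager (fst p `` {x})"
      by (rule meager_subset)
    then show ?thesis
      using open_not_meager[OF open_rect_open_section[OF p(1)]] by blast
  qed
  then have "fst p = {}"
    by auto
  then have "H \<inter> (\<Inter>n. snd p n) = {}"
    by (simp add: p(3))
  then show ?thesis
    by (rule that[OF p(2)])
qed

text \<open>Coding patterns by natural numbers makes quantifiers over them countable and allows
  Borel selection by \<open>LEAST\<close>.\<close>

lemma agree_on_bit:
  fixes z :: cantor
  obtains i :: nat where "agree_on {n..<m} (bit i) = agree_on {n..<m} z"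
proof
  let ?i = "horner_sum of_bool 2 (map z [0..<m]) :: nat"
  show "agree_on {n..<m} (bit ?i) = agree_on {n..<m} z"
    by (auto simp: agree_on_def bit_horner_sum_bit_iff)
qed

text \<open>\<open>Q n m i x\<close> is to mean that the pattern coded by \<open>i\<close> on
  \<open>{n..<m}\<close> forces a point into the dense open sets at \<open>x\<close> of index up to
  \<open>n\<close>. The converse direction works from these four properties alone.\<close>

lemma M_set_avoids_blocks:
  assumes "M_set H"
  obtains Q :: "nat \<Rightarrow> nat \<Rightarrow> nat \<Rightarrow> cantor \<Rightarrow> bool"
  where "\<And>n m i. {x. Q n m i x} \<in> sets borel"
    and "\<And>n m m' i x. Q n m i x \<Longrightarrow> m \<le> m' \<Longrightarrow> Q n m' i x"
    and "\<And>n x. \<exists>m i. Q n m i x"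
    and "\<And>x y. (x, y) \<in> H \<Longrightarrow>
      \<forall>\<^sub>F n in sequentially. \<forall>m i. Q n m i x \<longrightarrow> y \<notin> agree_on {n..<m} (bit i)"
proof -
  obtain V where "dense_rect_opens V" and H: "H \<inter> (\<Inter>n. V n) = {}"
    by (rule M_set_avoids_rect_open[OF assms])
  then have V: "rect_open (V n)" "closure (V n `` {x}) = UNIV" for n x
    by (simp_all add: dense_rect_opens_def)
  define Q where "Q n m i x \<longleftrightarrow> (\<forall>j\<le>n. agree_on {n..<m} (bit i) \<subseteq> V j `` {x})" for n m i :: nat and x
  show ?thesis
  proof (rule that[of Q])
    fix n m i
    have "{x. Q n m i x} = (\<Inter>j\<le>n. {x. agree_on {n..<m} (bit i) \<subseteq> V j `` {x}})"
      by (auto simp: Q_def)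
    then show "{x. Q n m i x} \<in> sets borel"
      using rect_open_compact_section[OF V(1) compact_agree_on] by auto
  next
    fix n m m' i x assume "Q n m i x" "m \<le> m'"
    then show "Q n m' i x"
      using agree_on_antimono[of "{n..<m}" "{n..<m'}" "bit i"] by (fastforce simp: Q_def)
  next
    fix n x
    have "open (\<Inter>j\<in>{..n}. V j `` {x})" "closure (\<Inter>j\<in>{..n}. V j `` {x}) = UNIV"
      using V(2) open_rect_open_section[OF V(1)] by (intro open_INT dense_open_INT; simp)+
    then obtain m z where "agree_on {n..<m} z \<subseteq> (\<Inter>j\<in>{..n}. V j `` {x})"
      using dense_open_contains_agree_on by metis
    then show "\<exists>m i. Q n m i x"
      unfolding Q_def by (metis INT_subset_iff agree_on_bit atMost_iff)
  next
    fix x y assume "(x, y) \<in> H"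
    then obtain j where "y \<notin> V j `` {x}"
      using H by blast
    then show "\<forall>\<^sub>F n in sequentially. \<forall>m i. Q n m i x \<longrightarrow> y \<notin> agree_on {n..<m} (bit i)"
      unfolding eventually_sequentially Q_def by blast
  qed
qed

section \<open>Borel functions on a subset and their extension\<close>

lemma measurable_borel_discrete:
  "measurable M (borel :: 'b::discrete_topology measure) = measurable M (count_space UNIV)"
proof (rule measurable_cong_sets)
  show "sets (borel :: 'b measure) = sets (count_space UNIV)"
    using borel_open[OF open_discrete] by auto
qed simp

text \<open>Each fibre of \<open>f\<close> is the trace on \<open>X\<close> of a measurable set.
  These sets may overlap outside \<open>X\<close>, so the least index is taken; on \<open>X\<close>
  it is the right one.\<close>

lemma measurable_extend_countable:
  fixes f :: "'a \<Rightarrow> 'b::countable"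
  assumes f: "f \<in> measurable (restrict_space M X) (count_space UNIV)"
  obtains g where "g \<in> measurable M (count_space UNIV)" "\<And>x. x \<in> X \<inter> space M \<Longrightarrow> g x = f x"
proof -
  have "\<exists>B\<in>sets M. {x \<in> X \<inter> space M. to_nat (f x) = i} = X \<inter> B" for i
  proof -
    have "f -` {v. to_nat v = i} \<inter> space (restrict_space M X) \<in> sets (restrict_space M X)"
      using f by (rule measurable_sets) simp
    moreover have "f -` {v. to_nat v = i} \<inter> space (restrict_space M X) = {x \<in> X \<inter> space M. to_nat (f x) = i}"
      by (auto simp: space_restrict_space)
    ultimately show ?thesis
      by (auto simp: sets_restrict_space)
  qed
  then obtain B where B: "\<And>i. B i \<in> sets M" "\<And>i. {x \<in> X \<inter> space M. to_nat (f x) = i} = X \<inter> B i"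
    by metis
  show ?thesis
  proof
    have [measurable]: "Measurable.pred M (\<lambda>x. x \<in> B i)" for i
      using B(1) by measurable
    show "(\<lambda>x. from_nat (LEAST i. x \<in> B i)) \<in> measurable M (count_space UNIV)"
      by measurable
    fix x assume x: "x \<in> X \<inter> space M"
    then have "x \<in> B i \<longleftrightarrow> to_nat (f x) = i" for i
      using B(2)[of i] by blast
    then show "from_nat (LEAST i. x \<in> B i) = f x"
      by (simp add: Least_equality)
  qed
qed

text \<open>Extending coordinate by coordinate covers both target spaces at once and reduces the
  necessity proofs to functions on the whole space.\<close>

lemma borel_image_of_extend:
  fixes Y :: "(nat \<Rightarrow> 'b::{countable, discrete_topology, second_countable_topology}) set"
  assumes "borel_image_of Y X"
  obtains g where "g \<in> borel_measurable borel" "Y = g ` X"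
proof -
  obtain f where f: "f \<in> restrict_space borel X \<rightarrow>\<^sub>M borel" and Y: "Y = f ` X"
    using assms by (auto simp: borel_image_of_def)
  have "\<exists>g. g \<in> borel_measurable borel \<and> (\<forall>x\<in>X. g x = f x n)" for n
  proof -
    have "(\<lambda>x. f x n) \<in> measurable (restrict_space borel X) (count_space UNIV)"
      using measurable_product_then_coordinatewise[OF f, of n] by (simp add: measurable_borel_discrete)
    then obtain g where "g \<in> measurable borel (count_space UNIV)" "\<And>x. x \<in> X \<Longrightarrow> g x = f x n"
      by (rule measurable_extend_countable) auto
    then show ?thesis
      by (auto simp: measurable_borel_discrete)
  qed
  then obtain g where g: "\<And>n. g n \<in> borel_measurable borel" "\<And>n x. x \<in> X \<Longrightarrow> g n x = f x n"
    by metis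
  show ?thesis
  proof
    show "(\<lambda>x n. g n x) \<in> borel_measurable borel"
      by (rule measurable_coordinatewise_then_product) (rule g)
    show "Y = (\<lambda>x n. g n x) ` X"
      unfolding Y using g(2) by (intro image_cong refl) auto
  qed
qed

lemma borel_image_of_image:
  "g \<in> borel_measurable borel \<Longrightarrow> borel_image_of (g ` X) X"
  unfolding borel_image_of_def by (blast intro: measurable_restrict_space1)

section \<open>Necessity of additivity and boundedness\<close>

lemma meager_image_cantor_add:
  assumes "meager A"
  shows "meager (cantor_add x ` A)"
proof -
  obtain V :: "nat \<Rightarrow> cantor set" where V: "\<And>n. open (V n)" "\<And>n. closure (V n) = UNIV" "A \<inter> (\<Inter>n. V n) = {}"
    using assms by (auto simp: meager_iff_dense_open)
  have "cantor_add x ` A \<inter> (\<Inter>n. cantor_add x ` V n) = cantor_add x -` (A \<inter> (\<Inter>n. V n))"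
    by (simp add: image_cantor_add vimage_INT)
  then show ?thesis
    unfolding meager_iff_dense_open using V
    by (intro exI[of _ "\<lambda>n. cantor_add x ` V n"]) (simp add: open_image_cantor_add dense_image_cantor_add)
qed

lemma borel_measurable_cantor_add:
  assumes "f \<in> borel_measurable M" "g \<in> borel_measurable M"
  shows "(\<lambda>x. cantor_add (f x) (g x)) \<in> borel_measurable M"
proof (rule measurable_coordinatewise_then_product)
  fix n
  have [measurable]: "Measurable.pred M (\<lambda>x. f x n)" "Measurable.pred M (\<lambda>x. g x n)"
    using assms[THEN measurable_product_then_coordinatewise, of n] by (simp_all add: measurable_borel_discrete)
  show "(\<lambda>x. cantor_add (f x) (g x) n) \<in> borel_measurable M"
    unfolding measurable_borel_discrete cantor_add_def by measurable
qed

lemma fst_borel [measurable]: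
  "fst \<in> borel_measurable (borel :: ('a::topological_space \<times> 'b::topological_space) measure)"
  by (intro borel_measurable_continuous_onI continuous_on_fst continuous_on_id)

lemma snd_borel [measurable]:
  "snd \<in> borel_measurable (borel :: ('a::topological_space \<times> 'b::topological_space) measure)"
  by (intro borel_measurable_continuous_onI continuous_on_snd continuous_on_id)

lemma SR_M_imp_M_additive:
  assumes "SR_M X" and g: "g \<in> borel_measurable borel"
  shows "M_additive (g ` X)"
  unfolding M_additive_def
proof (intro allI impI)
  fix F :: "cantor set" assume "meager F"
  then obtain V :: "nat \<Rightarrow> cantor set" where V: "\<And>n. open (V n)" "\<And>n. closure (V n) = UNIV" "F \<inter> (\<Inter>n. V n) = {}"
    by (auto simp: meager_iff_dense_open)
  \<comment> \<open>A meager F-sigma set containing \<open>F\<close>, which itself need not be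
    Borel.\<close>
  define C where "C = - (\<Inter>n. V n)"
  have "meager C"
    unfolding meager_iff_dense_open C_def using V by (intro exI[of _ V]) auto
  have "C \<in> sets borel"
    unfolding C_def using V(1) by (auto intro!: sets.countable_INT'' borel_open borel_comp)
  define H where "H = {p. cantor_add (g (fst p)) (snd p) \<in> C}"
  have section_H: "H `` {x} = cantor_add (g x) ` C" for x
    by (auto simp: H_def image_cantor_add)
  have "(\<lambda>p. cantor_add (g (fst p)) (snd p)) \<in> borel_measurable borel"
    by (intro borel_measurable_cantor_add measurable_compose[OF fst_borel g] snd_borel)
  from measurable_sets[OF this \<open>C \<in> sets borel\<close>] have "H \<in> sets borel"
    by (simp add: H_def vimage_def)
  then have "M_set H"
    using \<open>meager C\<close> by (simp add: M_set_def section_H meager_image_cantor_add)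
  then have "meager (\<Union>x\<in>X. H `` {x})"
    using assms(1) by (simp add: SR_M_def)
  moreover have "F \<subseteq> C"
    using V(3) by (auto simp: C_def)
  then have "cantor_setsum (g ` X) F \<subseteq> (\<Union>x\<in>X. H `` {x})"
    by (auto simp: cantor_setsum_def section_H)
  ultimately show "meager (cantor_setsum (g ` X) F)"
    by (rule meager_subset)
qed

definition eventually_hitting :: "(nat \<Rightarrow> nat) \<Rightarrow> cantor set" where
  "eventually_hitting h = {y. \<forall>\<^sub>F n in sequentially. \<exists>k\<in>{n..h n}. y k}"

lemma meager_eventually_hitting:
  assumes "\<And>n. n \<le> h n"
  shows "meager (eventually_hitting h)"
proof -
  \<comment> \<open>Block \<open>k\<close> becomes exactly \<open>{a k..h (a k)}\<close>, whence the
    \<open>Suc\<close>; hitting it excludes the zero pattern.\<close>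
  define a where "a k = ((\<lambda>n. Suc (h n)) ^^ k) 0" for k
  have a_Suc: "a (Suc k) = Suc (h (a k))" for k
    by (simp add: a_def)
  have a: "strict_mono a"
    using assms by (simp add: strict_mono_Suc_iff a_Suc le_imp_less_Suc)
  have "eventually_hitting h \<subseteq> eventually_avoiding a (\<lambda>_. False)"
  proof
    fix y assume "y \<in> eventually_hitting h"
    then have "\<forall>\<^sub>F k in sequentially. \<exists>j\<in>{a k..h (a k)}. y j"
      unfolding eventually_hitting_def using eventually_subseq[OF a] by auto
    then show "y \<in> eventually_avoiding a (\<lambda>_. False)"
      unfolding eventually_avoiding_def mem_Collect_eq
      by (rule eventually_mono) (auto simp: agree_on_def a_Suc)
  qed
  then show ?thesis
    using meager_eventually_avoiding[OF a] meager_subset by blast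
qed

text \<open>
  If \<^term>\<open>f\<close> exceeds the bound at \<^term>\<open>n\<close>, the points hitting all \<open>{n..h n}\<close> are unconstrained on
  the block after that of \<^term>\<open>n\<close>, except at its last place. Copying \<^term>\<open>z\<close>, which is true there,
  on infinitely many such blocks yields a point that is not eventually avoiding.
\<close>

lemma eventually_hitting_subset_imp_bounded:
  assumes a: "strict_mono a" "a 0 = 0"
    and z: "\<And>k. z (a (Suc k) - 1)"
    and h: "\<And>n. n \<le> h n" "\<And>j n. j \<le> n \<Longrightarrow> f j \<le> h n"
    and sub: "eventually_hitting h \<subseteq> eventually_avoiding a z"
  shows "\<forall>\<^sub>F n in sequentially. f n \<le> a (Suc (Suc (block_of a n)))"
proof (rule ccontr)
  let ?\<kappa> = "block_of a"
  assume "\<not> ?thesis"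
  then have large: "\<exists>n\<ge>N. a (Suc (Suc (?\<kappa> n))) < f n" for N
    by (auto simp: eventually_sequentially not_le)
  define J where "J = {Suc (?\<kappa> n) | n. a (Suc (Suc (?\<kappa> n))) < f n}"
  define y where "y j = (if ?\<kappa> j \<in> J then z j else True)" for j
  have "\<exists>k\<in>{n..h n}. y k" for n
  proof (cases "?\<kappa> n \<in> J")
    case False
    then show ?thesis
      using h(1) by (intro bexI[of _ n]) (auto simp: y_def)
  next
    case True
    then obtain m where m: "?\<kappa> n = Suc (?\<kappa> m)" "a (Suc (Suc (?\<kappa> m))) < f m"
      by (auto simp: J_def)
    \<comment> \<open>The last place of the block of \<open>n\<close>, where \<open>z\<close> is
      true. It is within reach because \<open>h n\<close> majorises \<open>f m\<close> for the
      earlier \<open>m\<close>, and \<open>f m\<close> exceeds the end of this block.\<close>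
    let ?k = "a (Suc (?\<kappa> n)) - 1"
    have n: "a (?\<kappa> n) \<le> n" "n < a (Suc (?\<kappa> n))"
      using in_block_of[OF a, of n] by auto
    have "m < n"
      using in_block_of[OF a, of m] n(1) by (simp add: m(1))
    then have "f m \<le> h n"
      by (intro h(2)) simp
    then have "?k \<in> {n..h n}"
      using m n by auto
    moreover have "?\<kappa> ?k = ?\<kappa> n"
      using n by (intro block_of_eq[OF a(1)]) auto
    then have "y ?k"
      using z by (simp add: y_def)
    ultimately show ?thesis
      by blast
  qed
  then have "y \<in> eventually_avoiding a z"
    using sub by (auto simp: eventually_hitting_def)
  then obtain K where K: "\<And>k. k \<ge> K \<Longrightarrow> y \<notin> agree_on {a k..<a (Suc k)} z"
    by (auto simp: eventually_avoiding_def eventually_sequentially)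
  obtain n where n: "n \<ge> a K" "a (Suc (Suc (?\<kappa> n))) < f n"
    using large by blast
  \<comment> \<open>The violation is taken at or beyond \<open>a K\<close>, so the block after it
    has index at least \<open>K\<close>, where no match is allowed.\<close>
  have "a K < a (Suc (?\<kappa> n))"
    using n(1) in_block_of[OF a, of n] by simp
  then have "K \<le> Suc (?\<kappa> n)"
    using a(1) by (simp add: strict_mono_less)
  moreover have "Suc (?\<kappa> n) \<in> J"
    unfolding J_def using n(2) by blast
  then have "y j = z j" if "j \<in> {a (Suc (?\<kappa> n))..<a (Suc (Suc (?\<kappa> n)))}" for j
    using block_of_eq[OF a(1) that] by (simp add: y_def)
  then have "y \<in> agree_on {a (Suc (?\<kappa> n))..<a (Suc (Suc (?\<kappa> n)))} z"
    by (simp add: agree_on_def)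
  ultimately show False
    using K by blast
qed

lemma SR_M_imp_eventually_bounded:
  fixes g :: "cantor \<Rightarrow> baire"
  assumes "SR_M X" and g: "g \<in> borel_measurable borel"
  shows "eventually_bounded (g ` X)"
proof -
  \<comment> \<open>The sum dominates \<open>g x\<close> at all arguments up to \<open>n\<close>;
    the summand \<open>n\<close> keeps \<open>{n..h x n}\<close> nonempty.\<close>
  define h where "h x n = n + (\<Sum>j\<le>n. g x j)" for x n
  have h: "n \<le> h x n" "j \<le> n \<Longrightarrow> g x j \<le> h x n" for x j n
    by (auto simp: h_def intro!: trans_le_add2 member_le_sum)
  define H where "H = {p. snd p \<in> eventually_hitting (h (fst p))}"
  have section_H: "H `` {x} = eventually_hitting (h x)" for x
    by (auto simp: H_def)
  have [measurable]: "(\<lambda>p :: cantor \<times> cantor. g (fst p) n) \<in> borel_measurable borel" for n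
    by (rule measurable_product_then_coordinatewise[OF measurable_compose[OF fst_borel g]])
  have "(\<lambda>p :: cantor \<times> cantor. h (fst p) n) \<in> borel_measurable borel" for n
    unfolding h_def by measurable
  then have [measurable]: "(\<lambda>p :: cantor \<times> cantor. h (fst p) n) \<in> measurable borel (count_space UNIV)" for n
    by (simp add: measurable_borel_discrete)
  have [measurable]: "Measurable.pred borel (\<lambda>p :: cantor \<times> cantor. snd p n)" for n
    by (subst measurable_borel_discrete[symmetric], rule measurable_product_then_coordinatewise[OF snd_borel])
  \<comment> \<open>Spelled out with countable quantifiers over bits, the condition is visibly
    Borel.\<close>
  have "H = {p \<in> space borel. \<exists>N. \<forall>n. N \<le> n \<longrightarrow> (\<exists>k. n \<le> k \<and> k \<le> h (fst p) n \<and> snd p k)}"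
    by (auto simp: H_def eventually_hitting_def eventually_sequentially Bex_def)
  also have "\<dots> \<in> sets borel"
    by measurable
  finally have "M_set H"
    using h(1) by (simp add: M_set_def section_H meager_eventually_hitting)
  then have "meager (\<Union>x\<in>X. eventually_hitting (h x))"
    unfolding section_H[symmetric] using assms(1) by (simp add: SR_M_def)
  then obtain a z where a: "strict_mono a" "a 0 = 0" "\<And>k. z (a (Suc k) - 1)"
    and sub: "(\<Union>x\<in>X. eventually_hitting (h x)) \<subseteq> eventually_avoiding a z"
    by (rule meager_subset_eventually_avoiding) (rule that)
  have "\<forall>\<^sub>F n in sequentially. g x n \<le> a (Suc (Suc (block_of a n)))" if "x \<in> X" for x
    by (rule eventually_hitting_subset_imp_bounded[of a z "h x"]) (use a h sub that in auto)
  then show ?thesis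
    unfolding eventually_bounded_def by (intro exI[of _ "\<lambda>n. a (Suc (Suc (block_of a n)))"]) auto
qed

section \<open>Sufficiency, and the theorem\<close>

text \<open>
  A common bound for the Borel functions measuring how long a block must be lets one choose the
  blocks \<^term>\<open>a\<close> independently of \<^term>\<open>x\<close>; each section then lies in a translate, by a Borel function
  of \<^term>\<open>x\<close>, of one fixed meager set.
\<close>

lemma SR_M_if:
  assumes additive: "\<And>z :: cantor \<Rightarrow> cantor. z \<in> borel_measurable borel \<Longrightarrow> M_additive (z ` X)"
    and bounded: "\<And>f :: cantor \<Rightarrow> baire. f \<in> borel_measurable borel \<Longrightarrow> eventually_bounded (f ` X)"
  shows "SR_M X"
  unfolding SR_M_def
proof (intro allI impI)
  fix H assume "M_set H"
  then obtain Q :: "nat \<Rightarrow> nat \<Rightarrow> nat \<Rightarrow> cantor \<Rightarrow> bool"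
    where Q_sets: "\<And>n m i. {x. Q n m i x} \<in> sets borel"
    and Q_mono: "\<And>n m m' i x. Q n m i x \<Longrightarrow> m \<le> m' \<Longrightarrow> Q n m' i x"
    and Q_ex: "\<And>n x. \<exists>m i. Q n m i x"
    and Q_avoid: "\<And>x y. (x, y) \<in> H \<Longrightarrow>
      \<forall>\<^sub>F n in sequentially. \<forall>m i. Q n m i x \<longrightarrow> y \<notin> agree_on {n..<m} (bit i)"
    by (rule M_set_avoids_blocks) (rule that)
  have [measurable]: "Measurable.pred borel (Q n m i)" for n m i
    using Q_sets by (simp add: pred_def)
  define f where "f x n = (LEAST m. \<exists>i. Q n m i x)" for x n
  have "(\<lambda>x. f x n) \<in> borel_measurable borel" for n
    unfolding measurable_borel_discrete f_def by measurable
  then have "f \<in> borel_measurable borel"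
    by (rule measurable_coordinatewise_then_product)
  then obtain g where g: "\<And>x. x \<in> X \<Longrightarrow> \<forall>\<^sub>F n in sequentially. f x n \<le> g n"
    using bounded[of f] by (auto simp: eventually_bounded_def)
  \<comment> \<open>The maximum keeps the blocks nonempty where \<open>g\<close> is small.\<close>
  define a where "a k = ((\<lambda>n. max (Suc n) (g n)) ^^ k) 0" for k
  have a_Suc: "a (Suc k) = max (Suc (a k)) (g (a k))" for k
    by (simp add: a_def)
  have a: "strict_mono a"
    by (simp add: strict_mono_Suc_iff a_Suc less_max_iff_disj)
  \<comment> \<open>Where the bound \<open>g\<close> fails no code need exist and the value is
    unspecified, though still Borel in \<open>x\<close>; for \<open>x\<close> in \<open>X\<close>
    this concerns only finitely many \<open>k\<close>.\<close>
  define c where "c x k = (LEAST i. Q (a k) (a (Suc k)) i x)" for x k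
  have [measurable]: "(\<lambda>x. c x k) \<in> measurable borel (count_space UNIV)" for k
    unfolding c_def by measurable
  \<comment> \<open>\<open>z x\<close> is glued from the chosen patterns, block by block.\<close>
  define z where "z x j = bit (c x (block_of a j)) j" for x j
  have "(\<lambda>x. z x j) \<in> borel_measurable borel" for j
    unfolding measurable_borel_discrete z_def by measurable
  then have z: "z \<in> borel_measurable borel"
    by (rule measurable_coordinatewise_then_product)
  have "cantor_add (z x) y \<in> eventually_avoiding a (\<lambda>_. False)" if "x \<in> X" "(x, y) \<in> H" for x y
  proof -
    have "\<forall>\<^sub>F k in sequentially. f x (a k) \<le> g (a k) \<and>
        (\<forall>m i. Q (a k) m i x \<longrightarrow> y \<notin> agree_on {a k..<m} (bit i))"
      using eventually_subseq[OF a eventually_conj[OF g Q_avoid]] that by blast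
    then show ?thesis
      unfolding eventually_avoiding_def mem_Collect_eq
    proof (rule eventually_mono)
      fix k assume k: "f x (a k) \<le> g (a k) \<and> (\<forall>m i. Q (a k) m i x \<longrightarrow> y \<notin> agree_on {a k..<m} (bit i))"
      have "\<exists>i. Q (a k) (f x (a k)) i x"
        unfolding f_def using Q_ex by (rule LeastI_ex)
      moreover have "f x (a k) \<le> a (Suc k)"
        using k by (simp add: a_Suc le_max_iff_disj)
      ultimately have "\<exists>i. Q (a k) (a (Suc k)) i x"
        using Q_mono by blast
      then have "Q (a k) (a (Suc k)) (c x k) x"
        unfolding c_def by (rule LeastI_ex)
      then have "y \<notin> agree_on {a k..<a (Suc k)} (bit (c x k))"
        using k by blast
      moreover have "z x j = bit (c x k) j" if "j \<in> {a k..<a (Suc k)}" for j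
        using block_of_eq[OF a that] by (simp add: z_def)
      \<comment> \<open>After adding \<open>z x\<close>, vanishing on the block is the same as
        \<open>y\<close> matching the chosen pattern there.\<close>
      ultimately show "cantor_add (z x) y \<notin> agree_on {a k..<a (Suc k)} (\<lambda>_. False)"
        by (auto simp: agree_on_def cantor_add_def)
    qed
  qed
  then have "(\<Union>x\<in>X. H `` {x}) \<subseteq> cantor_setsum (z ` X) (eventually_avoiding a (\<lambda>_. False))"
    unfolding cantor_setsum_def by (auto intro: cantor_add_cantor_add[symmetric])
  moreover have "meager (cantor_setsum (z ` X) (eventually_avoiding a (\<lambda>_. False)))"
    using additive[OF z] meager_eventually_avoiding[OF a] by (simp add: M_additive_def)
  ultimately show "meager (\<Union>x\<in>X. H `` {x})"
    by (rule meager_subset[rotated])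
qed

theorem theorem2p3:
  fixes X :: "cantor set"
  shows "SR_M X \<longleftrightarrow>
    (\<forall>Y :: cantor set. borel_image_of Y X \<longrightarrow> M_additive Y) \<and>
    (\<forall>F :: baire set. borel_image_of F X \<longrightarrow> eventually_bounded F)"
proof
  assume X: "SR_M X"
  show "(\<forall>Y :: cantor set. borel_image_of Y X \<longrightarrow> M_additive Y) \<and>
    (\<forall>F :: baire set. borel_image_of F X \<longrightarrow> eventually_bounded F)"
  proof (intro conjI allI impI)
    fix Y :: "cantor set" assume "borel_image_of Y X"
    then obtain g where "g \<in> borel_measurable borel" "Y = g ` X"
      by (rule borel_image_of_extend)
    then show "M_additive Y"
      using SR_M_imp_M_additive[OF X] by simp
  next
    fix F :: "baire set" assume "borel_image_of F X"
    then obtain g where "g \<in> borel_measurable borel" "F = g ` X"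
      by (rule borel_image_of_extend)
    then show "eventually_bounded F"
      using SR_M_imp_eventually_bounded[OF X] by simp
  qed
next
  assume "(\<forall>Y :: cantor set. borel_image_of Y X \<longrightarrow> M_additive Y) \<and>
    (\<forall>F :: baire set. borel_image_of F X \<longrightarrow> eventually_bounded F)"
  then show "SR_M X"
    by (intro SR_M_if) (simp_all add: borel_image_of_image)
qed

end
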